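(* Let $\mathcal{F}$ be a continuous-time, uncertain, piecewise linear dynamical system on $\mathbb{R}^d$ with nonempty finite mode set $Q$, matrices $(A_q)_{q\in Q}$, and regions $H_q=\mathbb{R}^d$ for all $q\in Q$. Let $\epsilon\ge1$, $\theta>0$, $\delta>0$, and let $V(x)=\max_{c\in\mathcal{V}}c^\top x$ be an $(\epsilon,\theta,\delta)$-robust polyhedral Lyapunov function for $\mathcal{F}$ with $\mathcal{V}_{\max}>0$. Then $V$ is a Lyapunov function for any $\gamma$-perturbation of System $\mathcal{F}$ with $\gamma\in(0,\frac{\delta}{a_{\max}})$.
   Context: $\|\cdot\|$ is a vector norm on $\mathbb{R}^d$ ($d\ge1$), with dual norm $\|c\|_*=\max\{c^\top x:\|x\|=1\}$ and induced matrix norm $\|A\|=\max\{\|Ax\|:\|x\|=1\}$. A continuous-time, uncertain, piecewise linear dynamical system is given by a finite set of modes $Q$ and, for each $q\in Q$, a closed polyhedral conic region $H_q\subseteq\mathbb{R}^d$ and a matrix $A_q\in\mathbb{R}^{d\times d}$. It is identified with the set-valued map $\mathcal{F}(x)=\{A_qx: q\in Q,\ x\in H_q\}$. Here $a_{\max}=\max_{q\in Q}\|A_q\|$. A $\gamma$-perturbation of $\mathcal{F}$ (when all $H_q=\mathbb{R}^d$) is a system of the same type with the same mode set $Q$, regions $H'_q=\mathbb{R}^d$ for all $q$, and matrices $A'_q$ satisfying $\|A'_q-A_q\|\le\gamma a_{\max}$ for all $q\in Q$. A polyhedral function is a function $V(x)=\max_{c\in\mathcal{V}}c^\top x$ for a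 finite set $\mathcal{V}\subseteq\mathbb{R}^d$; a defining set $\mathcal{V}$ is fixed together with $V$, and $\mathcal{V}_{\max}=\max_{c\in\mathcal{V}}\|c\|_*$. The upper-right Dini derivative is $D^+f(x;v)=\limsup_{s\to0^+}\frac{f(x+sv)-f(x)}{s}$. A continuous $V:\mathbb{R}^d\to\mathbb{R}_{\ge0}$ is a potential Lyapunov function if $V(x)=0$ iff $x=0$ and $V$ is radially unbounded ($\lim_{r\to\infty}\inf\{V(x):\|x\|\ge r\}=\infty$); it is a Lyapunov function for a system $\mathcal{G}$ if moreover $D^+V(x;v)<0$ for all $x\ne0$ and $v\in\mathcal{G}(x)$. $V$ is an $(\epsilon,\theta,\delta)$-robust Lyapunov function for $\mathcal{F}$ iff: (D1) for all $x\in\mathbb{R}^d$, $V(x)\ge\frac1\epsilon\mathcal{V}_{\max}\|x\|$; and (D2) for all $x\in\mathbb{R}^d$, $v\in\mathcal{F}(x)$ and $c\in\mathcal{V}$, $c^\top v\le\frac1\theta(V(x)-c^\top x)-\delta\mathcal{V}_{\max}\|x\|$. *)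

theory Defs
  imports "HOL-Analysis.Analysis"
begin

text \<open>The type-class norm on \<^typ>\<open>real ^ 'n\<close> is the Euclidean one, so an arbitrary vector norm is
  a function \<open>N\<close>, passed explicitly to everything that depends on it.\<close>

definition vector_norm :: "(real ^ 'n \<Rightarrow> real) \<Rightarrow> bool" where
  "vector_norm N \<longleftrightarrow>
     (\<forall>x. 0 \<le> N x) \<and> (\<forall>x. N x = 0 \<longleftrightarrow> x = 0) \<and>
     (\<forall>a x. N (a *\<^sub>R x) = \<bar>a\<bar> * N x) \<and> (\<forall>x y. N (x + y) \<le> N x + N y)"

text \<open>The suprema in the next two definitions are maxima: when \<open>N\<close> is a vector norm, its unit
  sphere is nonempty and compact.\<close>

definition dual_norm :: "(real ^ 'n \<Rightarrow> real) \<Rightarrow> real ^ 'n \<Rightarrow> real" where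
  "dual_norm N c = (SUP x \<in> {x. N x = 1}. c \<bullet> x)"

definition matrix_norm :: "(real ^ 'n \<Rightarrow> real) \<Rightarrow> real ^ 'n ^ 'n \<Rightarrow> real" where
  "matrix_norm N A = (SUP x \<in> {x. N x = 1}. N (A *v x))"

record ('n::finite, 'q) pl_data =
  modes :: "'q set"
  region :: "'q \<Rightarrow> (real ^ 'n) set"
  mat_of :: "'q \<Rightarrow> real ^ 'n ^ 'n"

text \<open>Library polyhedra are finite intersections of closed half-spaces, hence closed; the empty
  set is a polyhedron and satisfies \<^const>\<open>cone\<close>, so it is excluded explicitly.\<close>

definition pl_system :: "('n::finite, 'q) pl_data \<Rightarrow> bool" where
  "pl_system F \<longleftrightarrow> finite (modes F) \<and>
     (\<forall>q\<in>modes F. polyhedron (region F q) \<and> cone (region F q) \<and> region F q \<noteq> {})"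

definition flow_map :: "('n::finite, 'q) pl_data \<Rightarrow> real ^ 'n \<Rightarrow> (real ^ 'n) set" where
  "flow_map F x = {mat_of F q *v x | q. q \<in> modes F \<and> x \<in> region F q}"

definition a_max :: "(real ^ 'n \<Rightarrow> real) \<Rightarrow> ('n::finite, 'q) pl_data \<Rightarrow> real" where
  "a_max N F = Max ((\<lambda>q. matrix_norm N (mat_of F q)) ` modes F)"

text \<open>Only meant for systems \<open>F\<close> whose regions are all the whole space.\<close>

definition perturbation ::
  "(real ^ 'n \<Rightarrow> real) \<Rightarrow> real \<Rightarrow> ('n::finite, 'q) pl_data \<Rightarrow> ('n, 'q) pl_data \<Rightarrow> bool" where
  "perturbation N \<gamma> F F' \<longleftrightarrow> pl_system F' \<and> modes F' = modes F \<and>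
     (\<forall>q\<in>modes F. region F' q = UNIV) \<and>
     (\<forall>q\<in>modes F. matrix_norm N (mat_of F' q - mat_of F q) \<le> \<gamma> * a_max N F)"

text \<open>A polyhedral function is represented by its defining set \<open>C\<close>, which has to be finite and
  nonempty.\<close>

definition polyhedral_fun :: "(real ^ 'n) set \<Rightarrow> real ^ 'n \<Rightarrow> real" where
  "polyhedral_fun C x = Max ((\<lambda>c. c \<bullet> x) ` C)"

definition C_max :: "(real ^ 'n \<Rightarrow> real) \<Rightarrow> (real ^ 'n) set \<Rightarrow> real" where
  "C_max N C = Max (dual_norm N ` C)"

definition upper_dini :: "(real ^ 'n \<Rightarrow> real) \<Rightarrow> real ^ 'n \<Rightarrow> real ^ 'n \<Rightarrow> ereal" where
  "upper_dini f x v = Limsup (at_right 0) (\<lambda>s. ereal ((f (x + s *\<^sub>R v) - f x) / s))"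

definition radially_unbounded :: "(real ^ 'n \<Rightarrow> real) \<Rightarrow> (real ^ 'n \<Rightarrow> real) \<Rightarrow> bool" where
  "radially_unbounded N V \<longleftrightarrow> ((\<lambda>r. INF x \<in> {x. r \<le> N x}. ereal (V x)) \<longlongrightarrow> \<infinity>) at_top"

definition potential_lyapunov :: "(real ^ 'n \<Rightarrow> real) \<Rightarrow> (real ^ 'n \<Rightarrow> real) \<Rightarrow> bool" where
  "potential_lyapunov N V \<longleftrightarrow> continuous_on UNIV V \<and> (\<forall>x. 0 \<le> V x) \<and>
     (\<forall>x. V x = 0 \<longleftrightarrow> x = 0) \<and> radially_unbounded N V"

definition lyapunov ::
  "(real ^ 'n \<Rightarrow> real) \<Rightarrow> ('n::finite, 'q) pl_data \<Rightarrow> (real ^ 'n \<Rightarrow> real) \<Rightarrow> bool" where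
  "lyapunov N G V \<longleftrightarrow> potential_lyapunov N V \<and>
     (\<forall>x v. x \<noteq> 0 \<longrightarrow> v \<in> flow_map G x \<longrightarrow> upper_dini V x v < 0)"

definition robust_lyapunov ::
  "(real ^ 'n \<Rightarrow> real) \<Rightarrow> real \<Rightarrow> real \<Rightarrow> real \<Rightarrow> ('n::finite, 'q) pl_data \<Rightarrow> (real ^ 'n) set \<Rightarrow> bool" where
  "robust_lyapunov N \<epsilon> \<theta> \<delta> F C \<longleftrightarrow>
     (\<forall>x. polyhedral_fun C x \<ge> 1 / \<epsilon> * C_max N C * N x) \<and>
     (\<forall>x. \<forall>v\<in>flow_map F x. \<forall>c\<in>C.
        c \<bullet> v \<le> 1 / \<theta> * (polyhedral_fun C x - c \<bullet> x) - \<delta> * C_max N C * N x)"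

end

theory Submission
  imports Defs
begin

text \<open>
  Every linear functional \<open>c\<close> of the defining set satisfies, along the unperturbed flow, a decrease
  condition with slack \<open>\<delta> * C_max N C * N x\<close>. Replacing a matrix \<open>A\<close> by \<open>A'\<close> changes
  \<open>c \<bullet> (A *v x)\<close> by \<open>c \<bullet> ((A' - A) *v x)\<close>, which the duality inequality and the operator bound
  (\<open>inner_le_dual_norm\<close>, \<open>norm_matrix_vector_le\<close>) estimate by
  \<open>C_max N C * \<gamma> * a_max N F * N x\<close>. As \<open>\<gamma> < \<delta> / a_max N F\<close>, a positive part
  \<open>\<eta> * N x\<close> of the slack is left.

  The surviving condition \<open>c \<bullet> v \<le> (V x - c \<bullet> x) / \<theta> - \<eta> * N x\<close> forces \<open>V\<close> to decrease
  (\<open>upper_dini_polyhedral_fun_le\<close>): for a step \<open>0 < s \<le> \<theta>\<close>, the value \<open>c \<bullet> (x + s *\<^sub>R v)\<close> is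
  at most a convex combination of \<open>c \<bullet> x\<close> and \<open>V x\<close> with weight \<open>s / \<theta>\<close> on the latter, hence
  at most \<open>V x\<close>, reduced by \<open>s * \<eta> * N x\<close>. The functionals that are not active at \<open>x\<close> may well
  grow along \<open>v\<close>, but too slowly to overtake the active ones before time \<open>\<theta>\<close>.

  The static part, that \<open>V\<close> is a potential Lyapunov function, follows from the linear lower bound
  on \<open>V\<close> (\<open>potential_lyapunov_polyhedral_fun\<close>).
\<close>

section \<open>Vector norms and their induced norms\<close>

lemma vector_norm_continuous:
  fixes N :: "real ^ 'n::finite \<Rightarrow> real"
  assumes "vector_norm N"
  shows "continuous_on UNIV N"
proof (rule convex_on_continuous)
  show "convex_on UNIV N"
  proof (rule convex_onI)
    fix t :: real and x y :: "real ^ 'n"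
    assume "0 < t" "t < 1"
    have "N ((1 - t) *\<^sub>R x + t *\<^sub>R y) \<le> N ((1 - t) *\<^sub>R x) + N (t *\<^sub>R y)"
      using assms unfolding vector_norm_def by blast
    also have "\<dots> = \<bar>1 - t\<bar> * N x + \<bar>t\<bar> * N y"
      using assms unfolding vector_norm_def by simp
    also have "\<dots> = (1 - t) * N x + t * N y"
      using \<open>0 < t\<close> \<open>t < 1\<close> by simp
    finally show "N ((1 - t) *\<^sub>R x + t *\<^sub>R y) \<le> (1 - t) * N x + t * N y" .
  qed auto
qed auto

text \<open>Equivalence of norms: \<open>N\<close> attains a positive minimum \<open>m\<close> on the Euclidean unit sphere, so
  the unit sphere of \<open>N\<close> lies in the Euclidean ball of radius \<open>1 / m\<close>.\<close>

lemma compact_vector_norm_sphere: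
  fixes N :: "real ^ 'n::finite \<Rightarrow> real"
  assumes "vector_norm N"
  shows "compact {x. N x = 1}"
proof -
  have cont: "continuous_on UNIV N"
    using assms by (rule vector_norm_continuous)
  obtain u where u: "u \<in> sphere 0 1" "\<forall>y\<in>sphere 0 1. N u \<le> N y"
    using continuous_attains_inf[of "sphere (0::real ^ 'n) 1" N]
      continuous_on_subset[OF cont] by auto
  have "u \<noteq> 0" using u(1) by auto
  then have pos: "0 < N u"
    using assms unfolding vector_norm_def by (metis order_le_less)
  have "norm x \<le> 1 / N u" if "N x = 1" for x
  proof -
    have "x \<noteq> 0" using that assms unfolding vector_norm_def by (metis zero_neq_one)
    then have "inverse (norm x) *\<^sub>R x \<in> sphere 0 1" by simp
    then have "N u \<le> N (inverse (norm x) *\<^sub>R x)" using u(2) by blast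
    also have "\<dots> = inverse (norm x)"
      using assms that unfolding vector_norm_def by simp
    finally show ?thesis
      using \<open>x \<noteq> 0\<close> pos by (simp add: field_simps)
  qed
  then have "bounded {x. N x = 1}"
    by (auto simp: bounded_iff)
  moreover have "closed {x. N x = 1}"
    using closed_Collect_eq[OF cont continuous_on_const] .
  ultimately show ?thesis by (simp add: compact_eq_bounded_closed)
qed

text \<open>The common source of the duality inequality and of the operator bound. Compactness of the
  sphere makes the supremum an upper bound, since the supremum of a set of reals that is not
  bounded above is a meaningless default value.\<close>

lemma homogeneous_le_Sup_sphere:
  fixes N :: "real ^ 'n::finite \<Rightarrow> real"
  assumes N: "vector_norm N"
    and cont: "continuous_on UNIV f"
    and hom: "\<And>r x. 0 \<le> r \<Longrightarrow> f (r *\<^sub>R x) = r * f x"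
  shows "f x \<le> (SUP y \<in> {y. N y = 1}. f y) * N x"
proof (cases "x = 0")
  case True
  then have "N x = 0" using N unfolding vector_norm_def by blast
  then show ?thesis using hom[of 0 x] True by simp
next
  case False
  then have pos: "0 < N x"
    using N unfolding vector_norm_def by (metis order_le_less)
  define y where "y = inverse (N x) *\<^sub>R x"
  have y: "N y = 1"
    using N pos unfolding vector_norm_def y_def by (metis abs_inverse abs_of_pos left_inverse less_numeral_extra(3))
  have "compact (f ` {y. N y = 1})"
    using compact_vector_norm_sphere[OF N] continuous_on_subset[OF cont]
    by (intro compact_continuous_image) auto
  then have "bdd_above (f ` {y. N y = 1})"
    by (intro bounded_imp_bdd_above compact_imp_bounded)
  then have "f y \<le> (SUP y \<in> {y. N y = 1}. f y)"
    using y by (intro cSUP_upper) auto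
  then have "N x * f y \<le> N x * (SUP y \<in> {y. N y = 1}. f y)"
    using pos by (intro mult_left_mono) auto
  moreover have "f x = N x * f y"
    using pos hom[of "N x" y] by (simp add: y_def)
  ultimately show ?thesis by (simp add: mult.commute)
qed

lemma inner_le_dual_norm:
  fixes N :: "real ^ 'n::finite \<Rightarrow> real"
  assumes "vector_norm N"
  shows "c \<bullet> x \<le> dual_norm N c * N x"
  unfolding dual_norm_def
  by (rule homogeneous_le_Sup_sphere[OF assms]) (auto intro!: continuous_intros)

lemma norm_matrix_vector_le:
  fixes N :: "real ^ 'n::finite \<Rightarrow> real"
  assumes "vector_norm N"
  shows "N (A *v x) \<le> matrix_norm N A * N x"
  unfolding matrix_norm_def
proof (rule homogeneous_le_Sup_sphere[OF assms])
  show "continuous_on UNIV (\<lambda>x. N (A *v x))"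
    using continuous_on_compose2[OF vector_norm_continuous[OF assms]
        matrix_vector_mult_linear_continuous_on[of UNIV A]] by auto
  show "N (A *v (r *\<^sub>R x)) = r * N (A *v x)" if "0 \<le> r" for r x
    using assms that unfolding vector_norm_def
    by (simp add: matrix_vector_mult_scaleR)
qed

section \<open>Polyhedral functions\<close>

lemma inner_le_polyhedral_fun:
  assumes "finite C" "c \<in> C"
  shows "c \<bullet> x \<le> polyhedral_fun C x"
  using assms unfolding polyhedral_fun_def by auto

lemma polyhedral_fun_leI:
  assumes "finite C" "C \<noteq> {}" "\<And>c. c \<in> C \<Longrightarrow> c \<bullet> x \<le> b"
  shows "polyhedral_fun C x \<le> b"
  using assms unfolding polyhedral_fun_def by auto

lemma polyhedral_fun_0:
  assumes "C \<noteq> {}"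
  shows "polyhedral_fun C 0 = 0"
  using assms by (simp add: polyhedral_fun_def image_constant_conv)

lemma polyhedral_fun_continuous:
  fixes C :: "(real ^ 'n::finite) set"
  assumes "finite C" "C \<noteq> {}"
  shows "continuous_on UNIV (polyhedral_fun C)"
proof (rule convex_on_continuous)
  show "convex_on UNIV (polyhedral_fun C)"
  proof (rule convex_onI)
    fix t :: real and x y :: "real ^ 'n"
    assume t: "0 < t" "t < 1"
    show "polyhedral_fun C ((1 - t) *\<^sub>R x + t *\<^sub>R y)
        \<le> (1 - t) * polyhedral_fun C x + t * polyhedral_fun C y"
    proof (rule polyhedral_fun_leI[OF assms])
      fix c assume "c \<in> C"
      then have "c \<bullet> x \<le> polyhedral_fun C x" "c \<bullet> y \<le> polyhedral_fun C y"
        using inner_le_polyhedral_fun assms(1) by auto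
      then have "(1 - t) * (c \<bullet> x) + t * (c \<bullet> y)
          \<le> (1 - t) * polyhedral_fun C x + t * polyhedral_fun C y"
        using t by (intro add_mono mult_left_mono) auto
      then show "c \<bullet> ((1 - t) *\<^sub>R x + t *\<^sub>R y)
          \<le> (1 - t) * polyhedral_fun C x + t * polyhedral_fun C y"
        by (simp add: inner_add_right)
    qed
  qed auto
qed auto

lemma radially_unbounded_linear_lower_bound:
  assumes "0 < k" and lower: "\<And>x. k * N x \<le> V x"
  shows "radially_unbounded N V"
  unfolding radially_unbounded_def tendsto_PInfty
proof
  fix b :: real
  show "\<forall>\<^sub>F r in at_top. ereal b < (INF x \<in> {x. r \<le> N x}. ereal (V x))"
    using eventually_gt_at_top[of "b / k"]
  proof eventually_elim
    case (elim r)
    have "ereal b < ereal (k * r)"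
      using elim \<open>0 < k\<close> by (simp add: field_simps)
    also have "\<dots> \<le> (INF x \<in> {x. r \<le> N x}. ereal (V x))"
    proof (rule INF_greatest)
      fix x assume "x \<in> {x. r \<le> N x}"
      then have "k * r \<le> k * N x" using \<open>0 < k\<close> by simp
      then show "ereal (k * r) \<le> ereal (V x)" using lower[of x] by simp
    qed
    finally show ?case .
  qed
qed

lemma potential_lyapunov_polyhedral_fun:
  fixes N :: "real ^ 'n::finite \<Rightarrow> real"
  assumes N: "vector_norm N" and C: "finite C" "C \<noteq> {}"
    and "0 < k" and lower: "\<And>x. k * N x \<le> polyhedral_fun C x"
  shows "potential_lyapunov N (polyhedral_fun C)"
proof -
  have nonneg: "0 \<le> k * N x" for x
    using N \<open>0 < k\<close> unfolding vector_norm_def by simp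
  have "x = 0" if "polyhedral_fun C x = 0" for x
  proof -
    have "k * N x = 0" using nonneg[of x] lower[of x] that by simp
    then show ?thesis using N \<open>0 < k\<close> unfolding vector_norm_def by simp
  qed
  then show ?thesis
    unfolding potential_lyapunov_def
    using polyhedral_fun_continuous[OF C] polyhedral_fun_0[OF C(2)]
      radially_unbounded_linear_lower_bound[OF \<open>0 < k\<close> lower] order_trans[OF nonneg lower]
    by auto
qed

text \<open>For a step \<open>s \<le> \<theta>\<close>, the assumed growth rate lets \<open>c \<bullet> x\<close> move only the fraction \<open>s / \<theta>\<close> of
  the way up to the current maximum, so no functional exceeds the maximum by more than
  \<open>- s * \<beta>\<close>. Hence the difference quotients themselves, and not only their limit, are bounded by
  \<open>- \<beta>\<close>.\<close>

lemma upper_dini_polyhedral_fun_le: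
  fixes x v :: "real ^ 'n::finite"
  assumes C: "finite C" "C \<noteq> {}" and "0 < \<theta>"
    and rate: "\<And>c. c \<in> C \<Longrightarrow> c \<bullet> v \<le> 1 / \<theta> * (polyhedral_fun C x - c \<bullet> x) - \<beta>"
  shows "upper_dini (polyhedral_fun C) x v \<le> ereal (- \<beta>)"
  unfolding upper_dini_def
proof (rule Limsup_bounded)
  have "\<forall>\<^sub>F s in at_right 0. s \<in> {0<..<\<theta>}"
    using \<open>0 < \<theta>\<close> by (rule eventually_at_right_real)
  then show "\<forall>\<^sub>F s in at_right 0.
      ereal ((polyhedral_fun C (x + s *\<^sub>R v) - polyhedral_fun C x) / s) \<le> ereal (- \<beta>)"
  proof eventually_elim
    case (elim s)
    let ?V = "polyhedral_fun C x"
    have "polyhedral_fun C (x + s *\<^sub>R v) \<le> ?V - s * \<beta>"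
    proof (rule polyhedral_fun_leI[OF C])
      fix c assume c: "c \<in> C"
      have "s * (c \<bullet> v) \<le> s * (1 / \<theta> * (?V - c \<bullet> x) - \<beta>)"
        using rate[OF c] elim by (intro mult_left_mono) auto
      also have "\<dots> = s / \<theta> * (?V - c \<bullet> x) - s * \<beta>"
        by (simp add: right_diff_distrib)
      also have "\<dots> \<le> 1 * (?V - c \<bullet> x) - s * \<beta>"
        using elim \<open>0 < \<theta>\<close> inner_le_polyhedral_fun[OF C(1) c, of x]
        by (intro diff_right_mono mult_right_mono) auto
      finally show "c \<bullet> (x + s *\<^sub>R v) \<le> ?V - s * \<beta>"
        by (simp add: inner_add_right)
    qed
    then show ?case using elim by (simp add: field_simps)
  qed
qed

section \<open>Robustness under perturbation\<close>

theorem theorem11: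
  fixes N :: "real ^ 'n::finite \<Rightarrow> real"
    and F F' :: "('n::finite, 'q) pl_data"
    and C :: "(real ^ 'n) set"
    and \<epsilon> \<theta> \<delta> \<gamma> :: real
  assumes "vector_norm N"
    and "pl_system F" and "modes F \<noteq> {}" and "\<forall>q\<in>modes F. region F q = UNIV"
    and "\<epsilon> \<ge> 1" and "\<theta> > 0" and "\<delta> > 0"
    and "finite C" and "C \<noteq> {}"
    and "robust_lyapunov N \<epsilon> \<theta> \<delta> F C"
    and "C_max N C > 0"
    and "\<gamma> \<in> {0<..<\<delta> / a_max N F}"
    and "perturbation N \<gamma> F F'"
  shows "lyapunov N F' (polyhedral_fun C)"
proof -
  let ?V = "polyhedral_fun C"
  let ?M = "C_max N C"
  define \<eta> where "\<eta> = ?M * (\<delta> - \<gamma> * a_max N F)"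
  have nonneg: "0 \<le> N x" for x
    using assms(1) unfolding vector_norm_def by blast
  have "0 < \<delta> / a_max N F" using assms(12) by auto
  \<comment> \<open>\<open>a_max N F = 0\<close> is impossible: the interval for \<open>\<gamma>\<close> would then be empty, as \<open>\<delta> / 0 = 0\<close>.\<close>
  then have "0 < a_max N F" using \<open>\<delta> > 0\<close> by (simp add: zero_less_divide_iff)
  then have "\<gamma> * a_max N F < \<delta>" using assms(12) by (simp add: field_simps)
  then have "0 < \<eta>" using \<open>?M > 0\<close> by (simp add: \<eta>_def)
  have "potential_lyapunov N ?V"
    using assms(1,8-9)
  proof (rule potential_lyapunov_polyhedral_fun)
    show "0 < 1 / \<epsilon> * ?M" using \<open>\<epsilon> \<ge> 1\<close> \<open>?M > 0\<close> by simp
    show "1 / \<epsilon> * ?M * N x \<le> ?V x" for x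
      using assms(10) unfolding robust_lyapunov_def by blast
  qed
  moreover have "upper_dini ?V x v < 0" if "x \<noteq> 0" and flow: "v \<in> flow_map F' x" for x v
  proof -
    obtain q where q: "q \<in> modes F" and v: "v = mat_of F' q *v x"
      using flow assms(13) unfolding flow_map_def perturbation_def by auto
    define w where "w = mat_of F q *v x"
    define E where "E = mat_of F' q - mat_of F q"
    have v_eq: "v = w + E *v x"
      by (simp add: v w_def E_def matrix_vector_mult_diff_rdistrib)
    have w: "w \<in> flow_map F x"
      using q assms(4) unfolding flow_map_def w_def by auto
    have "N (E *v x) \<le> matrix_norm N E * N x"
      using assms(1) by (rule norm_matrix_vector_le)
    also have "\<dots> \<le> \<gamma> * a_max N F * N x"
      using q assms(13) nonneg unfolding perturbation_def E_def
      by (intro mult_right_mono) auto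
    finally have E: "N (E *v x) \<le> \<gamma> * a_max N F * N x" .
    have "upper_dini ?V x v \<le> ereal (- (\<eta> * N x))"
      using assms(8-9) \<open>\<theta> > 0\<close>
    proof (rule upper_dini_polyhedral_fun_le)
      fix c assume c: "c \<in> C"
      have "c \<bullet> (E *v x) \<le> dual_norm N c * N (E *v x)"
        using assms(1) by (rule inner_le_dual_norm)
      also have "\<dots> \<le> ?M * N (E *v x)"
        using c \<open>finite C\<close> nonneg unfolding C_max_def by (intro mult_right_mono) auto
      also have "\<dots> \<le> ?M * (\<gamma> * a_max N F * N x)"
        using E \<open>?M > 0\<close> by simp
      finally have "c \<bullet> (E *v x) \<le> ?M * (\<gamma> * a_max N F * N x)" .
      moreover have "c \<bullet> w \<le> 1 / \<theta> * (?V x - c \<bullet> x) - \<delta> * ?M * N x"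
        using assms(10) w c unfolding robust_lyapunov_def by blast
      ultimately show "c \<bullet> v \<le> 1 / \<theta> * (?V x - c \<bullet> x) - \<eta> * N x"
        by (simp add: v_eq \<eta>_def inner_add_right algebra_simps)
    qed
    also have "0 < N x"
      using \<open>x \<noteq> 0\<close> nonneg[of x] assms(1) unfolding vector_norm_def by (metis order_le_less)
    then have "ereal (- (\<eta> * N x)) < 0" using \<open>0 < \<eta>\<close> by simp
    finally show ?thesis .
  qed
  ultimately show ?thesis unfolding lyapunov_def by blast
qed

end
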